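(* Let $\beta\geq 1$ and let $X=(X(t))_{t\geq 0}$ be a real-valued (càdlàg) Lévy process with the $\beta$-scaling property, that is, $a^{-1/\beta}X(at)$ and $X(t)$ are equal in distribution for all $t,a>0$. Suppose that $X(1)$ is a random variable whose probability density function is non-vanishing almost everywhere on $\mathbb{R}$, i.e. it is $0$ only on a set of Lebesgue measure $0$. Then almost surely $$\dim_{\mathrm{A}} G_X^{[0,1]}=2 .$$
   Context: Lévy process: a stochastic process $X(t)$, $t\geq 0$, such that (1) $X(0)=0$ almost surely; (2) $X(t+h)-X(t)$ is equal in distribution to $X(h)$ for all $t,h>0$; (3) for all $0<t_1<\dots<t_k$ the increments $X(t_i)-X(t_{i-1})$ (with $t_0=0$) are independent; (4) for all $t>0$, $X(t+h)-X(t)\to 0$ in probability as $h\to 0$. It is taken in its càdlàg version (almost surely right continuous with left limits). Graph: for a càdlàg function $X$ and an interval $I$, $G_X^{I}=\{(t,y): y=X(t),\ t\in I\}\cup J$, where $J$ is the union of the vertical segments joining $(t,X(t-))$ to $(t,X(t))$ over the discontinuities $t\in I$ of $X$ ($X(t-)$ is the left limit). Assouad dimension: a non-empty compact set $F\subset\mathbb{R}^2$ is $s$-homogeneous if there is $C>0$ such that for all $R>0$, $r\in(0,R]$ and $x\in F$, $N(B(x,R)\cap F,r)\leq C(R/r)^s$, where $B(x,R)$ is the closed ball of centre $x$ and radius $R$ and $N(E,r)$ is the number of squares of the $r\times r$ grid that intersect $E$. Then $\dim_{\mathrm{A}}F=\inf\{s\geq 0: F\text{ is } s\text{-homogeneous}\}$.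 *)

theory Defs
  imports "HOL-Probability.Probability"
begin

text \<open>Processes are indexed by \<^typ>\<open>real\<close>; only the values at times \<open>t \<ge> 0\<close> are
  constrained or used. In \<open>stochastic_continuity\<close> the limit \<open>h \<rightarrow> 0\<close> is two-sided; since
  \<open>t > 0\<close>, only nonnegative times \<open>t + h\<close> matter.\<close>

locale levy_process = prob_space M
  for M :: "'w measure" and X :: "real \<Rightarrow> 'w \<Rightarrow> real" +
  assumes random_variable: "\<And>t. t \<ge> 0 \<Longrightarrow> random_variable borel (X t)"
    and start_zero: "AE \<omega> in M. X 0 \<omega> = 0"
    and stationary_increments:
      "\<And>t h. t > 0 \<Longrightarrow> h > 0 \<Longrightarrow>
         distr M borel (\<lambda>\<omega>. X (t + h) \<omega> - X t \<omega>) = distr M borel (X h)"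
    and independent_increments:
      "\<And>(k::nat) (t::nat \<Rightarrow> real). t 0 = 0 \<Longrightarrow> (\<And>i. i < k \<Longrightarrow> t i < t (Suc i)) \<Longrightarrow>
         indep_vars (\<lambda>_. borel) (\<lambda>i \<omega>. X (t i) \<omega> - X (t (i - 1)) \<omega>) {1..k}"
    and stochastic_continuity:
      "\<And>t \<epsilon>. t > 0 \<Longrightarrow> \<epsilon> > 0 \<Longrightarrow>
         ((\<lambda>h. prob {\<omega> \<in> space M. \<bar>X (t + h) \<omega> - X t \<omega>\<bar> > \<epsilon>}) \<longlongrightarrow> 0) (at 0)"

definition cadlag :: "(real \<Rightarrow> real) \<Rightarrow> bool" where
  "cadlag f \<longleftrightarrow>
     (\<forall>t\<ge>0. continuous (at_right t) f) \<and> (\<forall>t>0. \<exists>l. (f \<longlongrightarrow> l) (at_left t))"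

definition scaling_property :: "'w measure \<Rightarrow> real \<Rightarrow> (real \<Rightarrow> 'w \<Rightarrow> real) \<Rightarrow> bool" where
  "scaling_property M \<beta> X \<longleftrightarrow>
     (\<forall>t>0. \<forall>a>0. distr M borel (\<lambda>\<omega>. a powr (- 1 / \<beta>) * X (a * t) \<omega>) = distr M borel (X t))"

text \<open>Discontinuity is taken relative to the time domain \<open>{0..}\<close>, so that a right continuous
  function has no jump at time \<open>0\<close>.\<close>

definition discontinuities :: "(real \<Rightarrow> real) \<Rightarrow> real set" where
  "discontinuities f = {t. t \<ge> 0 \<and> \<not> continuous (at t within {0..}) f}"

definition cadlag_graph :: "real set \<Rightarrow> (real \<Rightarrow> real) \<Rightarrow> (real \<times> real) set" where
  "cadlag_graph I f =
     {(t, y). t \<in> I \<and> y = f t} \<union>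
     (\<Union>t \<in> I \<inter> discontinuities f. closed_segment (t, Lim (at_left t) f) (t, f t))"

definition grid_squares :: "real \<Rightarrow> (real \<times> real) set set" where
  "grid_squares r =
     {{of_int i * r .. (of_int i + 1) * r} \<times> {of_int j * r .. (of_int j + 1) * r} | i j :: int. True}"

definition grid_count :: "(real \<times> real) set \<Rightarrow> real \<Rightarrow> nat" where
  "grid_count E r = card {Q \<in> grid_squares r. Q \<inter> E \<noteq> {}}"

definition homogeneous :: "real \<Rightarrow> (real \<times> real) set \<Rightarrow> bool" where
  "homogeneous s F \<longleftrightarrow>
     (\<exists>C>0. \<forall>R>0. \<forall>r\<in>{0<..R}. \<forall>x\<in>F. real (grid_count (cball x R \<inter> F) r) \<le> C * (R / r) powr s)"

text \<open>The infimum is over a set that is bounded below and non-empty, every subset of the plane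
  being \<open>2\<close>-homogeneous, so it is meaningful as a real number.\<close>

definition assouad_dim :: "(real \<times> real) set \<Rightarrow> real" where
  "assouad_dim F = Inf {s. s \<ge> 0 \<and> homogeneous s F}"

end

theory Submission
  imports Defs
begin

text \<open>Cut \<open>[0,1]\<close> into \<open>m\<close> blocks of \<open>n\<close> columns of width \<open>\<tau> = 1 / (n m)\<close>. By scaling, the increments
  of \<open>X\<close> over the columns, divided by \<open>\<tau> powr (1 / \<beta>)\<close>, are independent copies of \<open>X 1\<close>, so
  within each block they follow a prescribed zigzag with a probability \<open>p > 0\<close> that does not
  depend on \<open>m\<close>; letting \<open>m\<close> grow, almost surely some block does. Since \<open>\<tau> \<le> \<tau> powr (1 / \<beta>)\<close> for
  \<open>\<beta> \<ge> 1\<close>, in such a block the graph, which is connected because its jumps are filled in, crosses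
  a common vertical range of length \<open>n \<tau>\<close> in every column, and so meets \<open>n\<^sup>2\<close> grid
  squares of side \<open>\<tau>\<close> in a ball of radius \<open>2 n \<tau>\<close>. As \<open>n\<close> is arbitrary, the dimension is at least 2.\<close>

section \<open>Grid counts and a criterion for Assouad dimension 2\<close>

lemma finite_card_int_Icc_real:
  fixes a b :: real
  assumes "a \<le> b"
  shows "finite {i::int. a \<le> of_int i \<and> of_int i \<le> b}"
    and "real (card {i::int. a \<le> of_int i \<and> of_int i \<le> b}) \<le> b - a + 1"
proof -
  have eq: "{i::int. a \<le> of_int i \<and> of_int i \<le> b} = {\<lceil>a\<rceil>..\<lfloor>b\<rfloor>}"
    by (auto simp: le_floor_iff ceiling_le_iff)
  show "finite {i::int. a \<le> of_int i \<and> of_int i \<le> b}"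
    unfolding eq by simp
  have "real_of_int \<lfloor>b\<rfloor> \<le> b" "a \<le> real_of_int \<lceil>a\<rceil>" by simp_all
  then show "real (card {i::int. a \<le> of_int i \<and> of_int i \<le> b}) \<le> b - a + 1"
    unfolding eq using assms by simp linarith
qed

text \<open>Grid squares indexed by integer pairs: for \<open>r > 0\<close> the indexing is
  injective, so counting squares becomes counting pairs.\<close>

definition grid_square :: "real \<Rightarrow> int \<times> int \<Rightarrow> (real \<times> real) set" where
  "grid_square r = (\<lambda>(i, j). {of_int i * r .. (of_int i + 1) * r} \<times> {of_int j * r .. (of_int j + 1) * r})"

lemma grid_squares_eq: "grid_squares r = range (grid_square r)"
  unfolding grid_squares_def grid_square_def by auto

lemma inj_grid_square:
  assumes "r > 0"
  shows "inj (grid_square r)"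
proof (rule injI)
  fix p q assume "grid_square r p = grid_square r q"
  moreover obtain i j k l where pq: "p = (i, j)" "q = (k, l)" by (cases p, cases q)
  ultimately have eq: "{of_int i * r .. (of_int i + 1) * r} \<times> {of_int j * r .. (of_int j + 1) * r} =
      {of_int k * r .. (of_int k + 1) * r} \<times> {of_int l * r .. (of_int l + 1) * r}"
    by (simp add: grid_square_def)
  have ne: "of_int x * r \<le> (of_int x + 1) * r" for x :: int
    using assms by (simp add: algebra_simps)
  have "{of_int i * r .. (of_int i + 1) * r} = {of_int k * r .. (of_int k + 1) * r} \<and>
      {of_int j * r .. (of_int j + 1) * r} = {of_int l * r .. (of_int l + 1) * r}"
    using eq ne by (subst (asm) times_eq_iff) auto
  then show "p = q"
    using assms ne by (auto simp: pq Icc_eq_Icc)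
qed

lemma dist_fst_snd_le:
  fixes x y :: "real \<times> real"
  shows "\<bar>fst x - fst y\<bar> \<le> dist x y" "\<bar>snd x - snd y\<bar> \<le> dist x y"
  by (metis dist_fst_le dist_real_def) (metis dist_snd_le dist_real_def)

text \<open>In each coordinate a ball of radius \<open>R\<close> meets at most 2 R / r + 2 \<le> 4 R
  / r closed grid intervals, whence 16 = 4 * 4. Finiteness is stated separately because
  \<open>card\<close> is 0 on infinite sets, so that lower bounds on \<open>grid_count\<close> by
  \<open>card_mono\<close> require it.\<close>

lemma grid_count_cball:
  fixes x :: "real \<times> real"
  assumes r: "0 < r" "r \<le> R"
  shows "finite {Q \<in> grid_squares r. Q \<inter> (cball x R \<inter> F) \<noteq> {}}"
    and "real (grid_count (cball x R \<inter> F) r) \<le> 16 * (R / r) powr 2"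
proof -
  \<comment> \<open>Indices of the closed grid intervals that can meet [a - R, a + R]. An index
    names the left end, so the -1 admits an interval that starts before a - R.\<close>
  define I where "I a = {i::int. (a - R) / r - 1 \<le> of_int i \<and> of_int i \<le> (a + R) / r}" for a :: real
  have ab: "(a - R) / r - 1 \<le> (a + R) / r" for a
  proof -
    have "(a - R) / r \<le> (a + R) / r" using r by (intro divide_right_mono) auto
    then show ?thesis by linarith
  qed
  have fin: "finite (I a)" for a
    unfolding I_def by (rule finite_card_int_Icc_real(1)[OF ab])
  have card: "real (card (I a)) \<le> 4 * (R / r)" for a
  proof -
    have "real (card (I a)) \<le> (a + R) / r - ((a - R) / r - 1) + 1"
      unfolding I_def by (rule finite_card_int_Icc_real(2)[OF ab])
    also have "\<dots> = 2 * (R / r) + 2" by (simp add: add_divide_distrib diff_divide_distrib)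
    also have "\<dots> \<le> 4 * (R / r)" using r by (simp add: field_simps)
    finally show ?thesis .
  qed
  have mem: "i \<in> I a" if "of_int i * r \<le> s" "s \<le> (of_int i + 1) * r" "\<bar>a - s\<bar> \<le> R" for i a s
  proof -
    have "of_int i * r \<le> a + R" "a - R \<le> (of_int i + 1) * r" using that by linarith+
    then show ?thesis
      unfolding I_def using r by (auto simp: field_simps)
  qed
  have sub: "{Q \<in> grid_squares r. Q \<inter> (cball x R \<inter> F) \<noteq> {}} \<subseteq> grid_square r ` (I (fst x) \<times> I (snd x))"
  proof
    fix Q assume "Q \<in> {Q \<in> grid_squares r. Q \<inter> (cball x R \<inter> F) \<noteq> {}}"
    then obtain i j s y where Q: "Q = grid_square r (i, j)"
      and sy: "(s, y) \<in> grid_square r (i, j)" "dist x (s, y) \<le> R"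
      by (auto simp: grid_squares_eq) metis
    have "\<bar>fst x - s\<bar> \<le> R" "\<bar>snd x - y\<bar> \<le> R"
      using dist_fst_snd_le[of x "(s, y)"] sy(2) by auto
    with sy(1) have "i \<in> I (fst x)" "j \<in> I (snd x)"
      by (auto simp: grid_square_def intro: mem)
    then show "Q \<in> grid_square r ` (I (fst x) \<times> I (snd x))" using Q by auto
  qed
  show "finite {Q \<in> grid_squares r. Q \<inter> (cball x R \<inter> F) \<noteq> {}}"
    by (rule finite_subset[OF sub]) (simp add: fin)
  have "grid_count (cball x R \<inter> F) r \<le> card (grid_square r ` (I (fst x) \<times> I (snd x)))"
    unfolding grid_count_def by (rule card_mono[OF _ sub]) (simp add: fin)
  also have "\<dots> \<le> card (I (fst x) \<times> I (snd x))"
    by (rule card_image_le) (simp add: fin)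
  also have "\<dots> = card (I (fst x)) * card (I (snd x))" by (rule card_cartesian_product)
  finally have "real (grid_count (cball x R \<inter> F) r) \<le> real (card (I (fst x))) * real (card (I (snd x)))"
    by (metis of_nat_le_iff of_nat_mult)
  also have "\<dots> \<le> (4 * (R / r)) * (4 * (R / r))"
    using r by (intro mult_mono card) auto
  also have "\<dots> = 16 * (R / r) powr 2"
    using r by (simp add: power2_eq_square)
  finally show "real (grid_count (cball x R \<inter> F) r) \<le> 16 * (R / r) powr 2" .
qed

lemma homogeneous_2: "homogeneous 2 F"
  unfolding homogeneous_def using grid_count_cball(2) by (intro exI[of _ 16]) auto

text \<open>For s < 2, homogeneity at the scales r and R = 2 n r gives n^2 \<le> C (2 n)^s, so n^(2
  - s) would stay bounded as n grows. The centre and \<open>r\<close> may vary with \<open>n\<close>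
  because \<open>C\<close> is uniform in both.\<close>

lemma assouad_dim_eq_2I:
  assumes "\<And>n::nat. n \<ge> 1 \<Longrightarrow> \<exists>x\<in>F. \<exists>r>0. real n ^ 2 \<le> real (grid_count (cball x (2 * real n * r) \<inter> F) r)"
  shows "assouad_dim F = 2"
proof -
  have ge: "2 \<le> s" if s: "homogeneous s F" for s
  proof (rule ccontr)
    assume "\<not> 2 \<le> s"
    then have "s < 2" by simp
    from s obtain C where C: "C > 0"
      "\<And>R r x. R > 0 \<Longrightarrow> r \<in> {0<..R} \<Longrightarrow> x \<in> F \<Longrightarrow> real (grid_count (cball x R \<inter> F) r) \<le> C * (R / r) powr s"
      unfolding homogeneous_def by blast
    have bound: "real n powr (2 - s) \<le> C * 2 powr s" if n: "n \<ge> 1" for n :: nat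
    proof -
      from assms[OF n] obtain x r where x: "x \<in> F" "r > 0"
        "real n ^ 2 \<le> real (grid_count (cball x (2 * real n * r) \<inter> F) r)" by blast
      have "real n powr 2 \<le> C * ((2 * real n * r) / r) powr s"
        using order_trans[OF x(3) C(2)[of "2 * real n * r" r x]] x n by simp
      also have "\<dots> = C * 2 powr s * real n powr s"
        using x by (simp add: powr_mult)
      finally show ?thesis
        using n by (simp add: powr_diff field_simps)
    qed
    define D where "D = C * 2 powr s"
    have "D > 0" using C by (simp add: D_def)
    \<comment> \<open>Chosen so that n^(2 - s) > D, against \<open>bound\<close>.\<close>
    obtain n :: nat where n: "D powr (1 / (2 - s)) < real n"
      using reals_Archimedean2 by blast
    then have "real n > 0" using powr_ge_zero order_le_less_trans by blast
    then have "n \<ge> 1" by simp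
    moreover have "(D powr (1 / (2 - s))) powr (2 - s) < real n powr (2 - s)"
      using n \<open>s < 2\<close> by (intro powr_less_mono2) auto
    then have "D < real n powr (2 - s)"
      using \<open>D > 0\<close> \<open>s < 2\<close> by (simp add: powr_powr)
    ultimately show False using bound[of n] by (simp add: D_def)
  qed
  show ?thesis
    unfolding assouad_dim_def
  proof (rule cInf_eq_minimum)
    show "2 \<in> {s. 0 \<le> s \<and> homogeneous s F}" by (simp add: homogeneous_2)
  qed (simp add: ge)
qed

section \<open>Intermediate values on graphs with filled-in jumps\<close>

text \<open>A cadlag function can miss the level \<open>y\<close> only by jumping over it, and this
  happens at the last exit time t = Sup {s. f s \<le> y}: right continuity excludes f t < y, and if
  f t > y then the left limit is at most y. The clause \<open>l \<noteq> f t\<close> later certifies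
  a discontinuity.\<close>

lemma cadlag_crossing_up:
  assumes f: "cadlag f" and ab: "0 \<le> a" "a \<le> b" and y: "f a \<le> y" "y \<le> f b"
  shows "\<exists>t\<in>{a..b}. f t = y \<or>
    (0 < t \<and> (\<exists>l. (f \<longlongrightarrow> l) (at_left t) \<and> l \<noteq> f t \<and> y \<in> closed_segment l (f t)))"
proof -
  define S where "S = {s \<in> {a..b}. f s \<le> y}"
  define t where "t = Sup S"
  have aS: "a \<in> S" using ab y by (simp add: S_def)
  have bdd: "bdd_above S" unfolding S_def by (rule bdd_aboveI[of _ b]) auto
  have ta: "a \<le> t" unfolding t_def by (rule cSup_upper[OF aS bdd])
  have tb: "t \<le> b" unfolding t_def using aS by (intro cSup_least) (auto simp: S_def)
  have above: "f s > y" if "t < s" "s \<le> b" for s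
  proof (rule ccontr)
    assume "\<not> f s > y"
    then have "s \<in> S" using that ta by (simp add: S_def)
    then have "s \<le> t" unfolding t_def by (rule cSup_upper[OF _ bdd])
    with that show False by simp
  qed
  consider "f t = y" | "f t < y" | "f t > y" by linarith
  then show ?thesis
  proof cases
    case 1
    then show ?thesis using ta tb by auto
  next
    case 2
    then have "t < b" using tb y by (cases "t = b") auto
    have "(f \<longlongrightarrow> f t) (at_right t)"
      using f ta ab by (auto simp: cadlag_def continuous_within)
    then have "eventually (\<lambda>s. f s < y) (at_right t)"
      using 2 by (rule order_tendstoD)
    moreover have "eventually (\<lambda>s. s \<in> {t<..<b}) (at_right t)"
      using \<open>t < b\<close> by (rule eventually_at_right_real)
    ultimately have "eventually (\<lambda>s. False) (at_right t)"
      by eventually_elim (use above in fastforce)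
    then show ?thesis by (simp add: trivial_limit_def[symmetric])
  next
    case 3
    then have "t \<noteq> a" using y by auto
    then have t0: "0 < t" using ta ab by simp
    obtain l where l: "(f \<longlongrightarrow> l) (at_left t)" using f t0 by (auto simp: cadlag_def)
    \<comment> \<open>If l > y, then f > y on some interval (c, t). The supremum property yields a
      point of \<open>S\<close> beyond c, and it is not t itself because f t > y.\<close>
    have "l \<le> y"
    proof (rule ccontr)
      assume "\<not> l \<le> y"
      then have "eventually (\<lambda>s. f s > y) (at_left t)"
        using l by (intro order_tendstoD) auto
      then obtain c where c: "c < t" "\<And>s. c < s \<Longrightarrow> s < t \<Longrightarrow> f s > y"
        using eventually_at_left[of "a" t] \<open>t \<noteq> a\<close> ta by auto
      obtain s where s: "s \<in> S" "c < s"
        using less_cSupD[of S c] aS c(1) unfolding t_def by auto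
      have "s \<le> t" unfolding t_def by (rule cSup_upper[OF s(1) bdd])
      moreover have "s \<noteq> t" using s 3 by (auto simp: S_def)
      ultimately show False using c(2)[of s] s by (auto simp: S_def)
    qed
    with 3 l t0 show ?thesis
      using ta tb by (intro bexI[of _ t]) (auto simp: closed_segment_eq_real_ivl)
  qed
qed

lemma cadlag_graph_crossing:
  assumes f: "cadlag f" and ab: "0 \<le> a" "a \<le> b" "{a..b} \<subseteq> I"
    and y: "f a \<le> y \<and> y \<le> f b \<or> f b \<le> y \<and> y \<le> f a"
  shows "\<exists>t\<in>{a..b}. (t, y) \<in> cadlag_graph I f"
proof -
  have "\<exists>t\<in>{a..b}. f t = y \<or>
    (0 < t \<and> (\<exists>l. (f \<longlongrightarrow> l) (at_left t) \<and> l \<noteq> f t \<and> y \<in> closed_segment l (f t)))"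
    using y
  proof
    assume "f a \<le> y \<and> y \<le> f b"
    then show ?thesis using cadlag_crossing_up[OF f ab(1,2)] by blast
  next
    assume *: "f b \<le> y \<and> y \<le> f a"
    \<comment> \<open>A downward crossing is an upward crossing of -f at level -y.\<close>
    have "cadlag (\<lambda>t. - f t)"
      using f unfolding cadlag_def by (auto intro!: continuous_minus) (metis tendsto_minus)
    then have "\<exists>t\<in>{a..b}. - f t = - y \<or>
      (0 < t \<and> (\<exists>l. ((\<lambda>t. - f t) \<longlongrightarrow> l) (at_left t) \<and> l \<noteq> - f t \<and> - y \<in> closed_segment l (- f t)))"
      using * ab by (intro cadlag_crossing_up) auto
    then obtain t where t: "t \<in> {a..b}" "f t = y \<or>
      (0 < t \<and> (\<exists>l. ((\<lambda>t. - f t) \<longlongrightarrow> l) (at_left t) \<and> l \<noteq> - f t \<and> - y \<in> closed_segment l (- f t)))"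
      by (metis neg_equal_iff_equal)
    have "(f \<longlongrightarrow> - l) (at_left t) \<and> - l \<noteq> f t \<and> y \<in> closed_segment (- l) (f t)"
      if "((\<lambda>t. - f t) \<longlongrightarrow> l) (at_left t)" "l \<noteq> - f t" "- y \<in> closed_segment l (- f t)" for l
      using that tendsto_minus[OF that(1)]
      by (auto simp: closed_segment_eq_real_ivl split: if_splits)
    with t show ?thesis by blast
  qed
  then obtain t where t: "t \<in> {a..b}" and or: "f t = y \<or>
    (0 < t \<and> (\<exists>l. (f \<longlongrightarrow> l) (at_left t) \<and> l \<noteq> f t \<and> y \<in> closed_segment l (f t)))" by blast
  have tI: "t \<in> I" using t ab by auto
  from or have "(t, y) \<in> cadlag_graph I f"
  proof
    assume "f t = y"
    then show ?thesis using tI by (auto simp: cadlag_graph_def)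
  next
    assume "0 < t \<and> (\<exists>l. (f \<longlongrightarrow> l) (at_left t) \<and> l \<noteq> f t \<and> y \<in> closed_segment l (f t))"
    then obtain l where t0: "0 < t" and l: "(f \<longlongrightarrow> l) (at_left t)" "l \<noteq> f t" "y \<in> closed_segment l (f t)"
      by blast
    have Lim: "Lim (at_left t) f = l"
      by (rule tendsto_Lim[OF _ l(1)]) simp
    have "\<not> continuous (at t within {0..}) f"
    proof
      assume "continuous (at t within {0..}) f"
      moreover have "at t within {0..} = at t"
        using t0 by (intro at_within_interior) simp
      ultimately have "(f \<longlongrightarrow> f t) (at t)" by (simp add: continuous_within)
      then have "(f \<longlongrightarrow> f t) (at_left t)" by (rule filterlim_mono) (auto intro: at_le)
      then show False using l tendsto_unique[OF _ l(1)] by auto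
    qed
    then have "t \<in> I \<inter> discontinuities f" using t0 tI by (simp add: discontinuities_def)
    moreover have "(t, y) \<in> closed_segment (t, l) (t, f t)"
    proof -
      \<comment> \<open>The segment is vertical, so the parameter \<open>u\<close> of the
        one-dimensional segment also serves in the plane.\<close>
      from l(3) obtain u where "0 \<le> u" "u \<le> 1" "y = (1 - u) * l + u * f t"
        by (auto simp: closed_segment_def)
      then show ?thesis unfolding closed_segment_def
        by (auto intro!: exI[of _ u] simp: algebra_simps)
    qed
    ultimately show ?thesis unfolding cadlag_graph_def using Lim by blast
  qed
  then show ?thesis using t by blast
qed

section \<open>From oscillations to many grid squares\<close>

text \<open>In each of the \<open>n\<close> columns the graph attains every height of a common band
  of height n \<tau>. The band contains \<open>n\<close> consecutive multiples of \<tau>, and a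
  graph point at such a height lies on the bottom edge of a grid square of that column, which gives
  n * n distinct squares.\<close>

lemma grid_count_ge_of_crossings:
  fixes k n :: nat and \<tau> y0 :: real
  assumes f: "cadlag f" and n: "n \<ge> 1" and \<tau>: "\<tau> > 0" and le1: "real (k + n) * \<tau> \<le> 1"
    and cross: "\<And>i y. i < n \<Longrightarrow> y0 \<le> y \<Longrightarrow> y \<le> y0 + real n * \<tau> \<Longrightarrow>
      f (real (k + i) * \<tau>) \<le> y \<and> y \<le> f (real (k + i + 1) * \<tau>) \<or>
      f (real (k + i + 1) * \<tau>) \<le> y \<and> y \<le> f (real (k + i) * \<tau>)"
  shows "\<exists>x\<in>cadlag_graph {0..1} f.
    real n ^ 2 \<le> real (grid_count (cball x (2 * real n * \<tau>) \<inter> cadlag_graph {0..1} f) \<tau>)"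
proof -
  define F where "F = cadlag_graph {0..1} f"
  have ex: "\<exists>t. real (k + i) * \<tau> \<le> t \<and> t \<le> real (k + i + 1) * \<tau> \<and> (t, y) \<in> F"
    if i: "i < n" and y: "y0 \<le> y" "y \<le> y0 + real n * \<tau>" for i y
  proof -
    have "real (k + i + 1) * \<tau> \<le> real (k + n) * \<tau>"
      using \<tau> i by (intro mult_right_mono) auto
    then have "real (k + i + 1) * \<tau> \<le> 1" using le1 by linarith
    moreover have "0 \<le> real (k + i) * \<tau>" using \<tau> by simp
    ultimately show ?thesis
      using cadlag_graph_crossing[OF f, of "real (k + i) * \<tau>" "real (k + i + 1) * \<tau>" "{0..1}" y]
        cross[OF i y] \<tau> unfolding F_def by (auto simp: mult_right_mono)
  qed
  obtain t0 where t0: "real k * \<tau> \<le> t0" "t0 \<le> real (k + 1) * \<tau>" "(t0, y0) \<in> F"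
    using ex[of 0 y0] n \<tau> by auto
  \<comment> \<open>The first grid height above \<open>y0\<close>. It overshoots by at most \<tau>,
    which still leaves room for the heights (J + j) \<tau> with j \<le> n - 1 in the band.\<close>
  define J where "J = \<lfloor>y0 / \<tau>\<rfloor> + 1"
  define sq where "sq = (\<lambda>(i::nat, j::nat). grid_square \<tau> (int (k + i), J + int j))"
  have J: "y0 \<le> of_int J * \<tau>" "of_int J * \<tau> \<le> y0 + \<tau>"
  proof -
    have "y0 / \<tau> \<le> of_int J" "of_int J \<le> y0 / \<tau> + 1" unfolding J_def by linarith+
    then show "y0 \<le> of_int J * \<tau>" "of_int J * \<tau> \<le> y0 + \<tau>" using \<tau> by (simp_all add: field_simps)
  qed
  have "inj_on sq ({..<n} \<times> {..<n})"
    unfolding sq_def by (auto simp: inj_on_def dest!: injD[OF inj_grid_square[OF \<tau>]])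
  then have card: "card (sq ` ({..<n} \<times> {..<n})) = n ^ 2"
    by (simp add: card_image power2_eq_square)
  have sub: "sq ` ({..<n} \<times> {..<n}) \<subseteq> {Q \<in> grid_squares \<tau>. Q \<inter> (cball (t0, y0) (2 * real n * \<tau>) \<inter> F) \<noteq> {}}"
  proof (rule image_subsetI)
    fix p assume "p \<in> {..<n} \<times> {..<n}"
    then obtain i j where p: "p = (i, j)" and ij: "i \<in> {..<n}" "j \<in> {..<n}" by blast
    define y where "y = of_int (J + int j) * \<tau>"
    have "real j * \<tau> + \<tau> \<le> real n * \<tau>"
    proof -
      have "(real j + 1) * \<tau> \<le> real n * \<tau>" using ij \<tau> by (intro mult_right_mono) auto
      then show ?thesis by (simp add: algebra_simps)
    qed
    moreover have "y = of_int J * \<tau> + real j * \<tau>" by (simp add: y_def algebra_simps)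
    moreover have "0 \<le> real j * \<tau>" using \<tau> by simp
    ultimately have y: "y0 \<le> y" "y \<le> y0 + real n * \<tau>" using J by linarith+
    obtain t where t: "real (k + i) * \<tau> \<le> t" "t \<le> real (k + i + 1) * \<tau>" "(t, y) \<in> F"
      using ex[of i y] ij y by auto
    have "real (k + i + 1) * \<tau> \<le> real (k + n) * \<tau>" "real (k + 1) * \<tau> \<le> real (k + n) * \<tau>"
      "real k * \<tau> \<le> real (k + i) * \<tau>"
      using ij n \<tau> by (auto intro!: mult_right_mono)
    with t t0 have "\<bar>t0 - t\<bar> \<le> real (k + n) * \<tau> - real k * \<tau>" by linarith
    then have "\<bar>t0 - t\<bar> \<le> real n * \<tau>" by (simp add: algebra_simps)
    moreover have "\<bar>y0 - y\<bar> \<le> real n * \<tau>" using y by linarith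
    \<comment> \<open>Each coordinate contributes at most n \<tau>, hence the radius 2 n
      \<tau>.\<close>
    moreover have "dist (t0, y0) (t, y) \<le> \<bar>t0 - t\<bar> + \<bar>y0 - y\<bar>"
      using sqrt_sum_squares_le_sum_abs[of "t0 - t" "y0 - y"] by (simp add: dist_prod_def dist_real_def)
    ultimately have "(t, y) \<in> cball (t0, y0) (2 * real n * \<tau>)" by simp
    moreover have "(t, y) \<in> sq (i, j)"
      using t \<tau> by (auto simp: sq_def grid_square_def y_def algebra_simps)
    ultimately have "sq p \<inter> (cball (t0, y0) (2 * real n * \<tau>) \<inter> F) \<noteq> {}"
      using t(3) p by blast
    moreover have "sq p \<in> grid_squares \<tau>"
      by (simp add: p sq_def grid_squares_eq)
    ultimately show "sq p \<in> {Q \<in> grid_squares \<tau>. Q \<inter> (cball (t0, y0) (2 * real n * \<tau>) \<inter> F) \<noteq> {}}"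
      by simp
  qed
  have "\<tau> \<le> 2 * real n * \<tau>" using n \<tau> by simp
  then have "n ^ 2 \<le> grid_count (cball (t0, y0) (2 * real n * \<tau>) \<inter> F) \<tau>"
    unfolding grid_count_def card[symmetric] using \<tau> sub
    by (intro card_mono grid_count_cball(1)) auto
  then have "real n ^ 2 \<le> real (grid_count (cball (t0, y0) (2 * real n * \<tau>) \<inter> F) \<tau>)"
    by (metis of_nat_le_iff of_nat_power)
  then show ?thesis using t0(3) unfolding F_def by blast
qed

text \<open>If \<open>n\<close> consecutive increments lie in these boxes, then the partial sums are at most \<open>n\<close> at even
  times and at least \<open>2 n\<close> at odd times: the errors, each in \<open>[0,1]\<close>, add up to at most \<open>n\<close>.\<close>

definition zigzag_box :: "nat \<Rightarrow> nat \<Rightarrow> real set" where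
  "zigzag_box n i = (let b = (if even i then 2 * real n else - 2 * real n) in {b .. b + 1})"

text \<open>Measured from the block's starting value, the path at column ends is alternately at most
  n c and at least 2 n c. So every column crosses the band from n c to 2 n c, whose height is at
  least n \<tau> because \<tau> \<le> c.\<close>

lemma grid_count_ge_of_zigzag:
  fixes k n :: nat and \<tau> c :: real
  assumes f: "cadlag f" and n: "n \<ge> 1" and \<tau>: "\<tau> > 0" and le1: "real (k + n) * \<tau> \<le> 1"
    and c: "\<tau> \<le> c"
    and zig: "\<And>i. i < n \<Longrightarrow> (f (real (k + i + 1) * \<tau>) - f (real (k + i) * \<tau>)) / c \<in> zigzag_box n i"
  shows "\<exists>x\<in>cadlag_graph {0..1} f.
    real n ^ 2 \<le> real (grid_count (cball x (2 * real n * \<tau>) \<inter> cadlag_graph {0..1} f) \<tau>)"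
proof -
  define S where "S i = f (real (k + i) * \<tau>) - f (real k * \<tau>)" for i
  have c0: "c > 0" using \<tau> c by simp
  \<comment> \<open>Each box has length 1, so each step adds an error between 0 and c to the ideal
    path, which alternates between 0 and 2 n c.\<close>
  have S: "(if odd i then 2 * real n * c else 0) \<le> S i \<and>
      S i \<le> (if odd i then 2 * real n * c else 0) + real i * c" if "i \<le> n" for i
    using that
  proof (induction i)
    case 0
    then show ?case by (simp add: S_def)
  next
    case (Suc i)
    have "(S (Suc i) - S i) / c \<in> zigzag_box n i"
      using zig[of i] Suc.prems by (simp add: S_def add.commute)
    then show ?case
      using Suc c0 by (auto simp: zigzag_box_def Let_def field_simps)
  qed
  have ev: "S i \<le> real n * c" if "even i" "i \<le> n" for i
  proof -
    have "real i * c \<le> real n * c" using that c0 by simp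
    then show ?thesis using S[OF that(2)] that by simp
  qed
  have od: "2 * real n * c \<le> S i" if "odd i" "i \<le> n" for i
    using S[OF that(2)] that by simp
  have nc: "real n * \<tau> + real n * c \<le> 2 * real n * c"
    using mult_left_mono[OF c, of "real n"] by linarith
  show ?thesis
  proof (rule grid_count_ge_of_crossings[OF f n \<tau> le1, where ?y0.0 = "f (real k * \<tau>) + real n * c"])
    fix i y assume i: "i < n" and y: "f (real k * \<tau>) + real n * c \<le> y"
      "y \<le> f (real k * \<tau>) + real n * c + real n * \<tau>"
    have "S i \<le> y - f (real k * \<tau>) \<and> y - f (real k * \<tau>) \<le> S (i + 1) \<or>
       S (i + 1) \<le> y - f (real k * \<tau>) \<and> y - f (real k * \<tau>) \<le> S i"
    proof (cases "even i")
      case True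
      then have "S i \<le> real n * c" "2 * real n * c \<le> S (i + 1)" using ev[of i] od[of "i + 1"] i by auto
      then show ?thesis using y nc by linarith
    next
      case False
      then have "S (i + 1) \<le> real n * c" "2 * real n * c \<le> S i" using od[of i] ev[of "i + 1"] i by auto
      then show ?thesis using y nc by linarith
    qed
    then show "f (real (k + i) * \<tau>) \<le> y \<and> y \<le> f (real (k + i + 1) * \<tau>) \<or>
      f (real (k + i + 1) * \<tau>) \<le> y \<and> y \<le> f (real (k + i) * \<tau>)"
      by (simp add: S_def add.assoc)
  qed
qed

section \<open>Almost sure existence of a zigzag block\<close>

text \<open>The failures of different blocks depend on disjoint groups of independent variables, so
  they are independent. Each has probability 1 minus the product of the \<open>q i\<close>, whatever
  the block.\<close>

lemma (in prob_space) prob_no_block_in_boxes: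
  fixes \<xi> :: "nat \<Rightarrow> 'a \<Rightarrow> real" and A :: "nat \<Rightarrow> real set" and q :: "nat \<Rightarrow> real"
  assumes indep: "indep_vars (\<lambda>_. borel) \<xi> {1..n * m}"
    and A: "\<And>i. A i \<in> sets borel"
    and q: "\<And>w i. w < m \<Longrightarrow> i < n \<Longrightarrow> prob {\<omega> \<in> space M. \<xi> (w * n + i + 1) \<omega> \<in> A i} = q i"
    and n: "n \<ge> 1" and m: "m \<ge> 1"
  shows "{\<omega> \<in> space M. \<forall>w<m. \<exists>i<n. \<xi> (w * n + i + 1) \<omega> \<notin> A i} \<in> events"
    and "prob {\<omega> \<in> space M. \<forall>w<m. \<exists>i<n. \<xi> (w * n + i + 1) \<omega> \<notin> A i} = (1 - (\<Prod>i<n. q i)) ^ m"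
proof -
  define K where "K w = (\<lambda>i. w * n + i + 1) ` {..<n}" for w
  have idx: "w * n + i + 1 \<in> {1..n * m}" if "w < m" "i < n" for w i
  proof -
    have "w * n + n \<le> m * n" using that mult_le_mono1[of "Suc w" m n] by simp
    then show ?thesis using that by (simp add: mult.commute)
  qed
  have KI: "K w \<subseteq> {1..n * m}" if "w < m" for w
    unfolding K_def using idx[OF that] by blast
  have disj: "disjoint_family_on K {..<m}"
  proof -
    have "w = w'" if "w * n + i + 1 = w' * n + i' + 1" "i < n" "i' < n" for w w' i i'
    proof -
      \<comment> \<open>Division by \<open>n\<close> recovers the block number from an index, once
        the shift by 1 is removed.\<close>
      have "(w * n + i) div n = (w' * n + i') div n" using that by simp
      then show ?thesis using that by simp
    qed
    then show ?thesis unfolding disjoint_family_on_def K_def by blast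
  qed
  have meas: "\<xi> j \<in> borel_measurable M" if "j \<in> {1..n * m}" for j
    using indep that unfolding indep_vars_def by auto
  define Y where "Y w = (\<lambda>\<omega>. restrict (\<lambda>j. \<xi> j \<omega>) (K w))" for w
  have indY: "indep_vars (\<lambda>w. PiM (K w) (\<lambda>_. borel)) Y {..<m}"
    unfolding Y_def using indep_vars_restrict[OF indep _ disj] KI by auto
  \<comment> \<open>The failure event of block \<open>w\<close>, as a set of vectors: the complement
    of the product of boxes. For j = w n + i + 1 in \<open>K w\<close>, the number j - 1 - w n is
    the position i inside the block.\<close>
  define B where "B w = space (PiM (K w) (\<lambda>_. borel :: real measure)) -
      PiE (K w) (\<lambda>j. A (j - 1 - w * n))" for w
  have B: "B w \<in> sets (PiM (K w) (\<lambda>_. borel))" for w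
    unfolding B_def by (intro sets.compl_sets sets_PiM_I_finite A) (simp add: K_def)
  have vim: "Y w -` B w \<inter> space M = space M - (\<Inter>j\<in>K w. \<xi> j -` A (j - 1 - w * n) \<inter> space M)" for w
    unfolding B_def Y_def K_def using n by (auto simp: space_PiM PiE_def Pi_def extensional_def)
  have pB: "prob (Y w -` B w \<inter> space M) = 1 - (\<Prod>i<n. q i)" if w: "w < m" for w
  proof -
    have "prob (\<Inter>j\<in>K w. \<xi> j -` A (j - 1 - w * n) \<inter> space M) =
        (\<Prod>j\<in>K w. prob (\<xi> j -` A (j - 1 - w * n) \<inter> space M))"
      using KI[OF w] n A by (intro indep_varsD[OF indep]) (auto simp: K_def lessThan_empty_iff)
    also have "\<dots> = (\<Prod>i<n. prob (\<xi> (w * n + i + 1) -` A i \<inter> space M))"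
      unfolding K_def by (subst prod.reindex) (auto simp: inj_on_def)
    also have "\<dots> = (\<Prod>i<n. q i)"
      using q[OF w] by (intro prod.cong) (auto simp: vimage_def Int_def conj_commute)
    finally have "prob (\<Inter>j\<in>K w. \<xi> j -` A (j - 1 - w * n) \<inter> space M) = (\<Prod>i<n. q i)" .
    moreover have "(\<Inter>j\<in>K w. \<xi> j -` A (j - 1 - w * n) \<inter> space M) \<in> events"
      using KI[OF w] n
      by (intro sets.finite_INT measurable_sets[OF meas] A) (auto simp: K_def lessThan_empty_iff)
    ultimately show ?thesis unfolding vim by (simp add: prob_compl)
  qed
  have eq: "{\<omega> \<in> space M. \<forall>w<m. \<exists>i<n. \<xi> (w * n + i + 1) \<omega> \<notin> A i} = (\<Inter>w\<in>{..<m}. Y w -` B w \<inter> space M)"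
    unfolding vim K_def using m n by (auto simp: lessThan_empty_iff)
  show "{\<omega> \<in> space M. \<forall>w<m. \<exists>i<n. \<xi> (w * n + i + 1) \<omega> \<notin> A i} \<in> events"
    unfolding eq
  proof (intro sets.finite_INT)
    fix w assume "w \<in> {..<m}"
    then have "Y w \<in> measurable M (PiM (K w) (\<lambda>_. borel))" using indY unfolding indep_vars_def by auto
    then show "Y w -` B w \<inter> space M \<in> events" using B by (rule measurable_sets)
  qed (use m in \<open>auto simp: lessThan_empty_iff\<close>)
  have "prob (\<Inter>w\<in>{..<m}. Y w -` B w \<inter> space M) = (\<Prod>w<m. prob (Y w -` B w \<inter> space M))"
    using m B by (intro indep_varsD[OF indY]) (auto simp: lessThan_empty_iff)
  then show "prob {\<omega> \<in> space M. \<forall>w<m. \<exists>i<n. \<xi> (w * n + i + 1) \<omega> \<notin> A i} = (1 - (\<Prod>i<n. q i)) ^ m"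
    unfolding eq using pB by simp
qed

text \<open>Stationarity replaces the increment by \<open>X \<tau>\<close>, and scaling with a =
  \<tau>, t = 1 replaces the normalised \<open>X \<tau>\<close> by \<open>X 1\<close>.\<close>

lemma (in levy_process) distr_normalised_increment:
  assumes sc: "scaling_property M \<beta> X" and \<tau>: "\<tau> > 0"
  shows "distr M borel (\<lambda>\<omega>. (X (real (j + 1) * \<tau>) \<omega> - X (real j * \<tau>) \<omega>) / \<tau> powr (1 / \<beta>)) =
    distr M borel (X 1)"
proof -
  let ?c = "\<tau> powr (1 / \<beta>)"
  have rv: "random_variable borel (X (real i * \<tau>))" "random_variable borel (X \<tau>)" for i
    using \<tau> by (auto intro: random_variable)
  have "distr M borel (\<lambda>\<omega>. X (real (j + 1) * \<tau>) \<omega> - X (real j * \<tau>) \<omega>) = distr M borel (X \<tau>)"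
  \<comment> \<open>Stationarity is assumed for starting times t > 0; the first column uses X 0 = 0
    almost surely instead.\<close>
  proof (cases "j = 0")
    case True
    have "AE \<omega> in M. X (real (j + 1) * \<tau>) \<omega> - X (real j * \<tau>) \<omega> = X \<tau> \<omega>"
      using start_zero by eventually_elim (simp add: True)
    then show ?thesis
      by (intro distr_cong_AE borel_measurable_diff rv) auto
  next
    case False
    then show ?thesis
      using stationary_increments[of "real j * \<tau>" \<tau>] \<tau> by (simp add: algebra_simps)
  qed
  then have "distr (distr M borel (\<lambda>\<omega>. X (real (j + 1) * \<tau>) \<omega> - X (real j * \<tau>) \<omega>)) borel (\<lambda>x. x / ?c) =
      distr (distr M borel (X \<tau>)) borel (\<lambda>x. x / ?c)" by simp
  then have "distr M borel (\<lambda>\<omega>. (X (real (j + 1) * \<tau>) \<omega> - X (real j * \<tau>) \<omega>) / ?c) =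
      distr M borel (\<lambda>\<omega>. X \<tau> \<omega> / ?c)"
    by (subst (asm) (1 2) distr_distr)
      (auto simp: comp_def simp del: of_nat_add of_nat_Suc intro!: borel_measurable_diff rv)
  also have "(\<lambda>\<omega>. X \<tau> \<omega> / ?c) = (\<lambda>\<omega>. \<tau> powr (- 1 / \<beta>) * X (\<tau> * 1) \<omega>)"
    by (simp add: powr_minus field_simps)
  also have "distr M borel \<dots> = distr M borel (X 1)"
    using sc \<tau> unfolding scaling_property_def by (metis zero_less_one)
  finally show ?thesis .
qed

text \<open>Were the probability 0, the density would vanish almost everywhere on [a, b], and this
  interval would be a null set.\<close>

lemma (in prob_space) prob_Icc_pos_of_density:
  fixes Z :: "'a \<Rightarrow> real"
  assumes d: "distributed M lborel Z f" and f: "AE x in lborel. f x \<noteq> 0" and "a < b"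
  shows "prob {\<omega> \<in> space M. Z \<omega> \<in> {a..b}} > 0"
proof (rule ccontr)
  assume "\<not> prob {\<omega> \<in> space M. Z \<omega> \<in> {a..b}} > 0"
  then have "prob (Z -` {a..b} \<inter> space M) = 0"
    by (simp add: vimage_def Int_def conj_commute zero_less_measure_iff)
  then have "emeasure M (Z -` {a..b} \<inter> space M) = 0" by (simp add: emeasure_eq_measure)
  then have "(\<integral>\<^sup>+x. f x * indicator {a..b} x \<partial>lborel) = 0"
    using distributed_emeasure[OF d, of "{a..b}"] by simp
  then have "AE x in lborel. f x * indicator {a..b} x = 0"
    using distributed_borel_measurable[OF d] by (subst (asm) nn_integral_0_iff_AE) auto
  with f have "AE x in lborel. x \<notin> {a..b}"
    by eventually_elim (auto simp: indicator_def split: if_splits)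
  then have "emeasure lborel {a..b} = 0"
    using AE_iff_measurable[of "{a..b}" lborel "\<lambda>x. x \<notin> {a..b}"]
    by (simp add: atLeastAtMost_def atLeast_def atMost_def Int_def)
  then show False using \<open>a < b\<close> by simp
qed

text \<open>For given \<open>m\<close>, all blocks fail with probability (1 - p)^m. Failure for
  every \<open>m\<close> at once lies inside each of these events, so it has probability 0; no
  independence between different \<open>m\<close> enters.\<close>

lemma (in levy_process) AE_exists_zigzag_block:
  assumes sc: "scaling_property M \<beta> X" and d: "distributed M lborel (X 1) f"
    and f: "AE x in lborel. f x \<noteq> 0" and n: "n \<ge> 1"
  shows "AE \<omega> in M. \<exists>m\<ge>1. \<exists>w<m. \<forall>i<n. let \<tau> = 1 / real (n * m) in
    (X (real (w * n + i + 1) * \<tau>) \<omega> - X (real (w * n + i) * \<tau>) \<omega>) / \<tau> powr (1 / \<beta>) \<in> zigzag_box n i"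
proof -
  define \<tau> where "\<tau> m = 1 / real (n * m)" for m
  define \<xi> where "\<xi> m j \<omega> = (X (real j * \<tau> m) \<omega> - X (real (j - 1) * \<tau> m) \<omega>) / \<tau> m powr (1 / \<beta>)" for m j \<omega>
  define q where "q i = prob {\<omega> \<in> space M. X 1 \<omega> \<in> zigzag_box n i}" for i
  define bad where "bad m = {\<omega> \<in> space M. \<forall>w<m. \<exists>i<n. \<xi> m (w * n + i + 1) \<omega> \<notin> zigzag_box n i}" for m
  define p where "p = (\<Prod>i<n. q i)"
  have box: "zigzag_box n i \<in> sets borel" for i by (simp add: zigzag_box_def Let_def)
  have "q i > 0" for i
    unfolding q_def zigzag_box_def Let_def by (rule prob_Icc_pos_of_density[OF d f]) simp
  \<comment> \<open>\<open>p\<close> is the same for every \<open>m\<close>, since after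
    normalisation the increments all have the law of \<open>X 1\<close>.\<close>
  then have p: "0 < p" "p \<le> 1"
    unfolding p_def by (auto intro!: prod_pos prod_le_1 simp: less_imp_le) (simp add: q_def)
  have bad: "bad m \<in> events" "prob (bad m) = (1 - p) ^ m" if m: "m \<ge> 1" for m
  proof -
    have \<tau>: "\<tau> m > 0" using n m by (simp add: \<tau>_def)
    have "indep_vars (\<lambda>_. borel) (\<lambda>j \<omega>. X (real j * \<tau> m) \<omega> - X (real (j - 1) * \<tau> m) \<omega>) {1..n * m}"
      using independent_increments[of "\<lambda>i. real i * \<tau> m" "n * m"] \<tau> by simp
    then have ind: "indep_vars (\<lambda>_. borel) (\<xi> m) {1..n * m}"
      unfolding \<xi>_def by (rule indep_vars_compose2[where Y = "\<lambda>_ x. x / \<tau> m powr (1 / \<beta>)"]) simp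
    have pr: "prob {\<omega> \<in> space M. \<xi> m (w * n + i + 1) \<omega> \<in> zigzag_box n i} = q i" for w i
    proof -
      have rv: "\<xi> m (w * n + i + 1) \<in> borel_measurable M" "X 1 \<in> borel_measurable M"
        unfolding \<xi>_def using \<tau>
        by (auto intro!: borel_measurable_divide borel_measurable_diff random_variable)
      have "distr M borel (\<xi> m (w * n + i + 1)) = distr M borel (X 1)"
        using distr_normalised_increment[OF sc \<tau>, of "w * n + i"] by (simp add: \<xi>_def[abs_def])
      then have "measure (distr M borel (\<xi> m (w * n + i + 1))) (zigzag_box n i) =
          measure (distr M borel (X 1)) (zigzag_box n i)" by simp
      then show ?thesis
        using rv box by (simp add: measure_distr q_def vimage_def Int_def conj_commute)
    qed
    show "bad m \<in> events" "prob (bad m) = (1 - p) ^ m"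
      unfolding bad_def p_def
      by (rule prob_no_block_in_boxes[OF ind box pr n m])+
  qed
  have ev: "(\<Inter>m\<in>{1..}. bad m) \<in> events"
    using bad(1) by (intro sets.countable_INT') auto
  have le: "prob (\<Inter>m\<in>{1..}. bad m) \<le> (1 - p) ^ m" if "m \<ge> 1" for m
    using that finite_measure_mono[OF _ bad(1)[OF that], of "\<Inter>m\<in>{1..}. bad m"] bad(2)[OF that] by auto
  have "(\<lambda>m. (1 - p) ^ m) \<longlonglongrightarrow> 0"
    using p by (intro LIMSEQ_realpow_zero) auto
  then have "prob (\<Inter>m\<in>{1..}. bad m) \<le> 0"
    by (rule LIMSEQ_le_const) (use le in blast)
  then have "emeasure M (\<Inter>m\<in>{1..}. bad m) = 0"
    by (simp add: emeasure_eq_measure measure_le_0_iff)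
  then have "(\<Inter>m\<in>{1..}. bad m) \<in> null_sets M" using ev by auto
  then have "AE \<omega> in M. \<omega> \<notin> (\<Inter>m\<in>{1..}. bad m)" by (rule AE_not_in)
  then show ?thesis
    using AE_space
    by eventually_elim (auto simp: bad_def \<xi>_def \<tau>_def Let_def)
qed

section \<open>Conclusion for almost every path\<close>

theorem theorem3p1:
  fixes M :: "'w measure" and X :: "real \<Rightarrow> 'w \<Rightarrow> real"
    and \<beta> :: real and f :: "real \<Rightarrow> ennreal"
  assumes "\<beta> \<ge> 1"
    and "levy_process M X"
    and "AE \<omega> in M. cadlag (\<lambda>t. X t \<omega>)"
    and "scaling_property M \<beta> X"
    and "distributed M lborel (X 1) f"
    and "AE x in lborel. f x \<noteq> 0"
  shows "AE \<omega> in M. assouad_dim (cadlag_graph {0..1} (\<lambda>t. X t \<omega>)) = 2"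
proof -
  interpret levy_process M X by fact
  define good where "good n \<omega> \<longleftrightarrow> (\<exists>m\<ge>1. \<exists>w<m. \<forall>i<n. let \<tau> = 1 / real (n * m) in
    (X (real (w * n + i + 1) * \<tau>) \<omega> - X (real (w * n + i) * \<tau>) \<omega>) / \<tau> powr (1 / \<beta>) \<in> zigzag_box n i)"
    for n \<omega>
  \<comment> \<open>One null set serves all \<open>n\<close>, as they are countably many.\<close>
  have "AE \<omega> in M. \<forall>n. n \<ge> 1 \<longrightarrow> good n \<omega>"
    unfolding AE_all_countable good_def using AE_exists_zigzag_block[OF assms(4-6)] by auto
  with assms(3) show ?thesis
  proof eventually_elim
    fix \<omega> assume cad: "cadlag (\<lambda>t. X t \<omega>)" and good: "\<forall>n. n \<ge> 1 \<longrightarrow> good n \<omega>"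
    show "assouad_dim (cadlag_graph {0..1} (\<lambda>t. X t \<omega>)) = 2"
    proof (rule assouad_dim_eq_2I)
      fix n :: nat assume n: "n \<ge> 1"
      with good obtain m w where mw: "m \<ge> 1" "w < m"
        "\<And>i. i < n \<Longrightarrow> (X (real (w * n + i + 1) * (1 / real (n * m))) \<omega> -
           X (real (w * n + i) * (1 / real (n * m))) \<omega>) / (1 / real (n * m)) powr (1 / \<beta>) \<in> zigzag_box n i"
        unfolding good_def Let_def by blast
      define \<tau> where "\<tau> = 1 / real (n * m)"
      have nm: "1 \<le> n * m" using n mw by simp
      then have "1 \<le> real (n * m)" by (metis of_nat_1 of_nat_le_iff)
      then have \<tau>: "0 < \<tau>" "\<tau> \<le> 1" unfolding \<tau>_def by (auto simp: field_simps)
      \<comment> \<open>Block \<open>w\<close> is one of \<open>m\<close> blocks of \<open>n\<close>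
        columns, so it ends by time n m \<tau> = 1.\<close>
      have "w * n + n \<le> n * m" using mw(2) mult_le_mono1[of "Suc w" m n] by (simp add: mult.commute)
      then have "real (w * n + n) \<le> real (n * m)" by (rule of_nat_mono)
      then have le1: "real (w * n + n) * \<tau> \<le> 1" unfolding \<tau>_def using nm by (simp add: field_simps)
      \<comment> \<open>Here \<beta> \<ge> 1 enters: as \<tau> \<le> 1, the vertical scale of the
        increments is at least the column width.\<close>
      have "\<tau> powr 1 \<le> \<tau> powr (1 / \<beta>)"
        using \<tau> assms(1) by (intro powr_mono') auto
      then have "\<tau> \<le> \<tau> powr (1 / \<beta>)" using \<tau> by simp
      then have "\<exists>x\<in>cadlag_graph {0..1} (\<lambda>t. X t \<omega>).
        real n ^ 2 \<le> real (grid_count (cball x (2 * real n * \<tau>) \<inter> cadlag_graph {0..1} (\<lambda>t. X t \<omega>)) \<tau>)"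
        using mw(3) unfolding \<tau>_def[symmetric]
        by (intro grid_count_ge_of_zigzag[OF cad n \<tau>(1) le1])
      then show "\<exists>x\<in>cadlag_graph {0..1} (\<lambda>t. X t \<omega>). \<exists>r>0.
        real n ^ 2 \<le> real (grid_count (cball x (2 * real n * r) \<inter> cadlag_graph {0..1} (\<lambda>t. X t \<omega>)) r)"
        using \<tau> by blast
    qed
  qed
qed

end
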